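(* Let $p,q\ge 1$ be integers and let $A_1,\dots,A_p>0$, $B_1,\dots,B_q>0$, $a_1,\dots,a_p\ge 0$, $b_1,\dots,b_q\ge 0$. Then $$P(u)=\sum_{i=1}^{p}\frac{e^{-a_iu/A_i}}{1-e^{-u/A_i}}-\sum_{j=1}^{q}\frac{e^{-b_ju/B_j}}{1-e^{-u/B_j}}\ge 0\quad\text{for all }u>0$$ if any one of the following conditions holds: (a) $\sum_{j=1}^{q}B_j=\sum_{i=1}^{p}A_i$ and $\max_{1\le i\le p}(a_i/A_i)\le \min_{1\le j\le q}(b_j-1)/B_j$; (b) $p=q$, $\sum_{i=1}^{p}B_i=\sum_{i=1}^{p}A_i$ with $A_i\ge B_i$ for $i=1,\dots,p-1$, and $$\max_{1\le k\le p-1}b_k/B_k\le (b_p-1)/B_p,\qquad a_i/A_i\le (b_i-1)/B_i\ \text{ for } i=1,\dots,p;$$ (c) $p=q$, $0\le a_1/A_1\le a_2/A_2\le\cdots\le a_p/A_p$, $0\le b_1/B_1\le b_2/B_2\le\cdots\le b_p/B_p$, $0<1/A_1\le 1/A_2\le\cdots\le 1/A_p$, $0<1/B_1\le 1/B_2\le\cdots\le 1/B_p$, and for each integer $k=1,\dots,p$ $$\sum_{i=1}^{k}\frac{a_i}{A_i}\le\sum_{i=1}^{k}\frac{b_i}{B_i},\qquad \sum_{i=1}^{k}\frac1{A_i}\le\sum_{i=1}^{k}\frac1{B_i}.$$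
   Context: In (b), when $p=1$ the condition involving a maximum over the empty set is vacuous. *)

theory Defs
  imports Complex_Main
begin

definition P_diff :: "nat \<Rightarrow> nat \<Rightarrow> (nat \<Rightarrow> real) \<Rightarrow> (nat \<Rightarrow> real) \<Rightarrow> (nat \<Rightarrow> real) \<Rightarrow> (nat \<Rightarrow> real) \<Rightarrow> real \<Rightarrow> real" where
  "P_diff p q A B a b u =
     (\<Sum>i=1..p. exp (- (a i * u / A i)) / (1 - exp (- (u / A i)))) -
     (\<Sum>j=1..q. exp (- (b j * u / B j)) / (1 - exp (- (u / B j))))"

end

theory Submission
  imports Defs
begin

text \<open>
  Every summand is \<open>exp (- x * u) / (1 - exp (- y * u))\<close> with \<open>x = a / A\<close> and \<open>y = 1 / A\<close>,
  and two different views of it settle the three cases.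

  Cases (a) and (b) rest on the sandwich
  \<open>1 / (exp s - 1) \<le> 1 / s \<le> 1 / (1 - exp (- s))\<close> for \<open>s > 0\<close>, both halves of which are
  \<open>1 + t \<le> exp t\<close>. With \<open>s = u / A\<close> it bounds a positive summand below by
  \<open>exp (- c * u) * A / u\<close> as soon as \<open>a / A \<le> c\<close>; with \<open>s = u / B\<close>, after cancelling a factor
  \<open>exp (u / B)\<close>, it bounds a negative summand above by \<open>exp (- c * u) * B / u\<close> as soon as
  \<open>c \<le> (b - 1) / B\<close>. The cancelled factor is the reason for the \<open>b - 1\<close> in the hypotheses.
  In case (a) one \<open>c\<close> serves all summands, and the bounds cancel because
  the \<open>A i\<close> and the \<open>B j\<close> have the same sum. In case (b) the \<open>i\<close>-th pair uses
  \<open>c = (b i - 1) / B i\<close>; for \<open>i < p\<close> this is at most \<open>(b p - 1) / B p\<close>, and since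
  \<open>A i - B i \<ge> 0\<close> the weight may be lowered to the common \<open>exp (- (b p - 1) / B p * u)\<close>, after
  which the bounds again cancel.

  Case (c) expands each summand into the geometric series
  \<open>\<Sum>n. exp (- u * (x + n * y))\<close>. For each fixed \<open>n\<close>, the numbers \<open>b i / B i + n / B i\<close> are
  increasing in \<open>i\<close> and their partial sums dominate those of \<open>a i / A i + n / A i\<close>, so the
  inequality for the \<open>n\<close>-th terms is an instance of weak majorization for the
  decreasing convex function \<open>\<lambda>t. exp (- u * t)\<close>. That instance follows from the tangent
  inequality and summation by parts.
\<close>

section \<open>Comparison with a common exponential\<close>

lemma exp_quotient_lower_bound:
  fixes A a c u :: real
  assumes "A > 0" "u > 0" "a / A \<le> c"
  shows "exp (- c * u) * (A / u) \<le> exp (- (a * u / A)) / (1 - exp (- (u / A)))"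
proof -
  have pos: "0 < 1 - exp (- (u / A))"
    using assms by simp
  have "1 - exp (- (u / A)) \<le> u / A"
    using exp_ge_add_one_self[of "- (u / A)"] by simp
  then have "A / u \<le> 1 / (1 - exp (- (u / A)))"
    using pos assms by (simp add: field_simps)
  moreover have "exp (- c * u) \<le> exp (- (a * u / A))"
    using mult_right_mono[OF assms(3), of u] assms(2) by simp
  ultimately have "exp (- c * u) * (A / u)
      \<le> exp (- (a * u / A)) * (1 / (1 - exp (- (u / A))))"
    using assms by (intro mult_mono) auto
  then show ?thesis by simp
qed

lemma exp_quotient_upper_bound:
  fixes B b c u :: real
  assumes "B > 0" "u > 0" "c \<le> (b - 1) / B"
  shows "exp (- (b * u / B)) / (1 - exp (- (u / B))) \<le> exp (- c * u) * (B / u)"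
proof -
  have "exp (- (b * u / B)) = exp (- ((b - 1) / B) * u) * exp (- (u / B))"
    using assms by (simp add: exp_add[symmetric] field_simps)
  moreover have "exp (- (u / B)) / (1 - exp (- (u / B))) = 1 / (exp (u / B) - 1)"
    using assms by (simp add: exp_minus field_simps)
  ultimately have eq: "exp (- (b * u / B)) / (1 - exp (- (u / B)))
      = exp (- ((b - 1) / B) * u) * (1 / (exp (u / B) - 1))"
    by (metis times_divide_eq_right)
  have "u / B \<le> exp (u / B) - 1"
    using exp_ge_add_one_self[of "u / B"] by linarith
  then have "1 / (exp (u / B) - 1) \<le> 1 / (u / B)"
    using assms by (intro divide_left_mono) auto
  then have "1 / (exp (u / B) - 1) \<le> B / u"
    by simp
  moreover have "exp (- ((b - 1) / B) * u) \<le> exp (- c * u)"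
    using mult_right_mono[OF assms(3), of u] assms(2) by simp
  ultimately show ?thesis
    unfolding eq using assms by (intro mult_mono) auto
qed

section \<open>Weak majorization for the exponential function\<close>

lemma sum_mult_antimono_weights_ge:
  fixes w x :: "nat \<Rightarrow> real"
  assumes "\<And>i. 1 \<le> i \<Longrightarrow> i < n \<Longrightarrow> w (Suc i) \<le> w i"
    and "\<And>k. k \<in> {1..n} \<Longrightarrow> 0 \<le> (\<Sum>i=1..k. x i)"
  shows "w n * (\<Sum>i=1..n. x i) \<le> (\<Sum>i=1..n. w i * x i)"
  using assms
proof (induction n)
  case 0
  then show ?case by simp
next
  case (Suc n)
  have IH: "w n * (\<Sum>i=1..n. x i) \<le> (\<Sum>i=1..n. w i * x i)"
    using Suc.prems by (intro Suc.IH) auto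
  have "w (Suc n) * (\<Sum>i=1..n. x i) \<le> w n * (\<Sum>i=1..n. x i)"
  proof (cases "n = 0")
    case False
    then show ?thesis
      using Suc.prems by (intro mult_right_mono) auto
  qed simp
  with IH show ?case by (simp add: distrib_left)
qed

text \<open>
  The tangent of the convex function \<open>\<lambda>t. exp (- u * t)\<close> at \<open>d i\<close> gives
  \<open>exp (- u * c i) - exp (- u * d i) \<ge> u * exp (- u * d i) * (d i - c i)\<close>. The slopes
  \<open>u * exp (- u * d i)\<close> decrease in \<open>i\<close>, so summation by parts turns the nonnegative partial sums
  of \<open>d i - c i\<close> into a nonnegative total.
\<close>

lemma sum_exp_weak_majorization:
  fixes c d :: "nat \<Rightarrow> real"
  assumes "u > 0" and mono: "mono_on {1..p} d"
    and partial: "\<And>k. k \<in> {1..p} \<Longrightarrow> (\<Sum>i=1..k. c i) \<le> (\<Sum>i=1..k. d i)"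
  shows "(\<Sum>i=1..p. exp (- u * d i)) \<le> (\<Sum>i=1..p. exp (- u * c i))"
proof -
  define w where "w i = u * exp (- u * d i)" for i
  have tangent: "w i * (d i - c i) \<le> exp (- u * c i) - exp (- u * d i)" for i
  proof -
    have "exp (- u * d i) * (1 + u * (d i - c i)) \<le> exp (- u * d i) * exp (u * (d i - c i))"
      using exp_ge_add_one_self by (intro mult_left_mono) auto
    also have "\<dots> = exp (- u * c i)"
      by (simp add: exp_add[symmetric] algebra_simps)
    finally show ?thesis by (simp add: w_def algebra_simps)
  qed
  have nonneg: "0 \<le> (\<Sum>i=1..k. d i - c i)" if "k \<in> {1..p}" for k
    using partial[OF that] by (simp add: sum_subtractf)
  have "0 \<le> (\<Sum>i=1..p. d i - c i)"
    using nonneg[of p] by (cases "p = 0") auto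
  then have "0 \<le> w p * (\<Sum>i=1..p. d i - c i)"
    using \<open>u > 0\<close> by (simp add: w_def)
  also have "\<dots> \<le> (\<Sum>i=1..p. w i * (d i - c i))"
  proof (rule sum_mult_antimono_weights_ge)
    fix i assume "1 \<le> i" "i < p"
    then have "d i \<le> d (Suc i)"
      by (intro mono_onD[OF mono]) auto
    then show "w (Suc i) \<le> w i"
      using \<open>u > 0\<close> by (simp add: w_def)
  qed (rule nonneg)
  also have "\<dots> \<le> (\<Sum>i=1..p. exp (- u * c i) - exp (- u * d i))"
    by (intro sum_mono tangent)
  finally show ?thesis by (simp add: sum_subtractf)
qed

lemma exp_quotient_sums:
  fixes A a u :: real
  assumes "A > 0" "u > 0"
  shows "(\<lambda>n. exp (- u * (a / A + real n * (1 / A))))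
    sums (exp (- (a * u / A)) / (1 - exp (- (u / A))))"
proof -
  have "(\<lambda>n. exp (- (u / A)) ^ n) sums (1 / (1 - exp (- (u / A))))"
    using assms by (intro geometric_sums) simp
  then have "(\<lambda>n. exp (- (a * u / A)) * exp (- (u / A)) ^ n)
      sums (exp (- (a * u / A)) * (1 / (1 - exp (- (u / A)))))"
    by (rule sums_mult)
  moreover have "exp (- (a * u / A)) * exp (- (u / A)) ^ n
      = exp (- u * (a / A + real n * (1 / A)))" for n
    by (simp add: exp_of_nat_mult[symmetric] exp_add[symmetric] algebra_simps)
  ultimately show ?thesis by simp
qed

section \<open>Nonnegativity in the three cases\<close>

lemma P_diff_nonneg_common_bound:
  assumes "u > 0"
    and "\<And>i. i \<in> {1..p} \<Longrightarrow> A i > 0" and "\<And>j. j \<in> {1..q} \<Longrightarrow> B j > 0"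
    and "\<And>i. i \<in> {1..p} \<Longrightarrow> a i / A i \<le> c"
    and "\<And>j. j \<in> {1..q} \<Longrightarrow> c \<le> (b j - 1) / B j"
    and eq: "(\<Sum>j=1..q. B j) = (\<Sum>i=1..p. A i)"
  shows "0 \<le> P_diff p q A B a b u"
proof -
  have "(\<Sum>j=1..q. exp (- (b j * u / B j)) / (1 - exp (- (u / B j))))
      \<le> (\<Sum>j=1..q. exp (- c * u) * (B j / u))"
    using assms by (intro sum_mono exp_quotient_upper_bound) auto
  also have "\<dots> = (\<Sum>i=1..p. exp (- c * u) * (A i / u))"
    using eq by (simp flip: sum_distrib_left sum_divide_distrib)
  also have "\<dots> \<le> (\<Sum>i=1..p. exp (- (a i * u / A i)) / (1 - exp (- (u / A i))))"
    using assms by (intro sum_mono exp_quotient_lower_bound) auto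
  finally show ?thesis by (simp add: P_diff_def)
qed

text \<open>
  The number \<open>c\<close> is to be thought of as \<open>(b p - 1) / B p\<close>. A pair with \<open>A i < B i\<close> has a
  negative lower bound, which lowering the weight would spoil; such pairs must therefore carry
  the weight of \<open>c\<close> from the start, which is the last hypothesis.
\<close>

lemma P_diff_nonneg_pairwise:
  assumes "u > 0"
    and "\<And>i. i \<in> {1..p} \<Longrightarrow> A i > 0" and "\<And>i. i \<in> {1..p} \<Longrightarrow> B i > 0"
    and ab: "\<And>i. i \<in> {1..p} \<Longrightarrow> a i / A i \<le> (b i - 1) / B i"
    and eq: "(\<Sum>i=1..p. B i) = (\<Sum>i=1..p. A i)"
    and c: "\<And>i. i \<in> {1..p} \<Longrightarrow>
      (b i - 1) / B i = c \<or> (B i \<le> A i \<and> (b i - 1) / B i \<le> c)"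
  shows "0 \<le> P_diff p p A B a b u"
proof -
  have "0 = (\<Sum>i=1..p. exp (- c * u) * ((A i - B i) / u))"
    using eq by (simp add: sum_subtractf flip: sum_distrib_left sum_divide_distrib)
  also have "\<dots> \<le> (\<Sum>i=1..p. exp (- (a i * u / A i)) / (1 - exp (- (u / A i)))
      - exp (- (b i * u / B i)) / (1 - exp (- (u / B i))))"
  proof (rule sum_mono)
    fix i assume i: "i \<in> {1..p}"
    define d where "d = (b i - 1) / B i"
    have "exp (- c * u) * ((A i - B i) / u) \<le> exp (- d * u) * ((A i - B i) / u)"
      using c[OF i] \<open>u > 0\<close> unfolding d_def[symmetric]
      by (elim disjE conjE) (simp, intro mult_right_mono, auto)
    also have "\<dots> = exp (- d * u) * (A i / u) - exp (- d * u) * (B i / u)"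
      by (simp add: diff_divide_distrib right_diff_distrib)
    also have "\<dots> \<le> exp (- (a i * u / A i)) / (1 - exp (- (u / A i)))
        - exp (- (b i * u / B i)) / (1 - exp (- (u / B i)))"
      using assms i
      by (intro diff_mono exp_quotient_lower_bound exp_quotient_upper_bound) (auto simp: d_def)
    finally show "exp (- c * u) * ((A i - B i) / u)
        \<le> exp (- (a i * u / A i)) / (1 - exp (- (u / A i)))
          - exp (- (b i * u / B i)) / (1 - exp (- (u / B i)))" .
  qed
  finally show ?thesis by (simp add: P_diff_def sum_subtractf)
qed

lemma P_diff_nonneg_majorization:
  assumes "u > 0"
    and "\<And>i. i \<in> {1..p} \<Longrightarrow> A i > 0" and "\<And>i. i \<in> {1..p} \<Longrightarrow> B i > 0"
    and mono: "mono_on {1..p} (\<lambda>i. b i / B i)" "mono_on {1..p} (\<lambda>i. 1 / B i)"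
    and le: "\<And>k. k \<in> {1..p} \<Longrightarrow> (\<Sum>i=1..k. a i / A i) \<le> (\<Sum>i=1..k. b i / B i)"
      "\<And>k. k \<in> {1..p} \<Longrightarrow> (\<Sum>i=1..k. 1 / A i) \<le> (\<Sum>i=1..k. 1 / B i)"
  shows "0 \<le> P_diff p p A B a b u"
proof -
  have "(\<Sum>i=1..p. exp (- (b i * u / B i)) / (1 - exp (- (u / B i))))
      \<le> (\<Sum>i=1..p. exp (- (a i * u / A i)) / (1 - exp (- (u / A i))))"
  proof (rule sums_le)
    show "(\<lambda>n. \<Sum>i=1..p. exp (- u * (b i / B i + real n * (1 / B i))))
        sums (\<Sum>i=1..p. exp (- (b i * u / B i)) / (1 - exp (- (u / B i))))"
      using assms by (intro sums_sum exp_quotient_sums) auto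
    show "(\<lambda>n. \<Sum>i=1..p. exp (- u * (a i / A i + real n * (1 / A i))))
        sums (\<Sum>i=1..p. exp (- (a i * u / A i)) / (1 - exp (- (u / A i))))"
      using assms by (intro sums_sum exp_quotient_sums) auto
  next
    fix n
    show "(\<Sum>i=1..p. exp (- u * (b i / B i + real n * (1 / B i))))
        \<le> (\<Sum>i=1..p. exp (- u * (a i / A i + real n * (1 / A i))))"
    proof (rule sum_exp_weak_majorization[OF \<open>u > 0\<close>])
      show "mono_on {1..p} (\<lambda>i. b i / B i + real n * (1 / B i))"
        by (intro mono_onI add_mono mult_left_mono mono_onD[OF mono(1)] mono_onD[OF mono(2)])
          auto
    next
      fix k assume k: "k \<in> {1..p}"
      show "(\<Sum>i=1..k. a i / A i + real n * (1 / A i))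
          \<le> (\<Sum>i=1..k. b i / B i + real n * (1 / B i))"
        unfolding sum.distrib sum_distrib_left[symmetric]
        by (intro add_mono mult_left_mono le k) auto
    qed
  qed
  then show ?thesis by (simp add: P_diff_def)
qed

theorem theorem5:
  fixes p q :: nat
    and A B a b :: "nat \<Rightarrow> real"
  assumes "p \<ge> 1" and "q \<ge> 1"
    and "\<And>i. i \<in> {1..p} \<Longrightarrow> A i > 0"
    and "\<And>j. j \<in> {1..q} \<Longrightarrow> B j > 0"
    and "\<And>i. i \<in> {1..p} \<Longrightarrow> a i \<ge> 0"
    and "\<And>j. j \<in> {1..q} \<Longrightarrow> b j \<ge> 0"
    and "((\<Sum>j=1..q. B j) = (\<Sum>i=1..p. A i) \<and>
          Max ((\<lambda>i. a i / A i) ` {1..p}) \<le> Min ((\<lambda>j. (b j - 1) / B j) ` {1..q}))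
       \<or> (p = q \<and> (\<Sum>i=1..p. B i) = (\<Sum>i=1..p. A i) \<and>
          (\<forall>i\<in>{1..p-1}. A i \<ge> B i) \<and>
          (p \<ge> 2 \<longrightarrow> Max ((\<lambda>k. b k / B k) ` {1..p-1}) \<le> (b p - 1) / B p) \<and>
          (\<forall>i\<in>{1..p}. a i / A i \<le> (b i - 1) / B i))
       \<or> (p = q \<and>
          0 \<le> a 1 / A 1 \<and> mono_on {1..p} (\<lambda>i. a i / A i) \<and>
          0 \<le> b 1 / B 1 \<and> mono_on {1..p} (\<lambda>i. b i / B i) \<and>
          0 < 1 / A 1 \<and> mono_on {1..p} (\<lambda>i. 1 / A i) \<and>
          0 < 1 / B 1 \<and> mono_on {1..p} (\<lambda>i. 1 / B i) \<and>
          (\<forall>k\<in>{1..p}. (\<Sum>i=1..k. a i / A i) \<le> (\<Sum>i=1..k. b i / B i) \<and>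
                       (\<Sum>i=1..k. 1 / A i) \<le> (\<Sum>i=1..k. 1 / B i)))"
  shows "\<forall>u>0. P_diff p q A B a b u \<ge> 0"
proof (intro allI impI)
  fix u :: real assume u: "u > 0"
  note A_pos = assms(3) and B_pos = assms(4)
  from assms(7) show "0 \<le> P_diff p q A B a b u"
  proof (elim disjE conjE)
    assume eq: "(\<Sum>j=1..q. B j) = (\<Sum>i=1..p. A i)"
      and le: "Max ((\<lambda>i. a i / A i) ` {1..p}) \<le> Min ((\<lambda>j. (b j - 1) / B j) ` {1..q})"
    show ?thesis
    proof (rule P_diff_nonneg_common_bound[OF u A_pos B_pos _ _ eq])
      fix i assume "i \<in> {1..p}"
      then show "a i / A i \<le> Max ((\<lambda>i. a i / A i) ` {1..p})"
        by (intro Max_ge) auto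
    next
      fix j assume "j \<in> {1..q}"
      then have "Min ((\<lambda>j. (b j - 1) / B j) ` {1..q}) \<le> (b j - 1) / B j"
        by (intro Min_le) auto
      with le show "Max ((\<lambda>i. a i / A i) ` {1..p}) \<le> (b j - 1) / B j"
        by linarith
    qed
  next
    assume pq: "p = q" and eq: "(\<Sum>i=1..p. B i) = (\<Sum>i=1..p. A i)"
      and AB: "\<forall>i\<in>{1..p-1}. A i \<ge> B i"
      and mx: "p \<ge> 2 \<longrightarrow> Max ((\<lambda>k. b k / B k) ` {1..p-1}) \<le> (b p - 1) / B p"
      and ab: "\<forall>i\<in>{1..p}. a i / A i \<le> (b i - 1) / B i"
    have "(b i - 1) / B i = (b p - 1) / B p
        \<or> (B i \<le> A i \<and> (b i - 1) / B i \<le> (b p - 1) / B p)" if i: "i \<in> {1..p}" for i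
    proof (cases "i = p")
      case False
      with i have i': "i \<in> {1..p-1}" "p \<ge> 2" by auto
      have "(b i - 1) / B i \<le> b i / B i"
        using B_pos[of i] i pq by (intro divide_right_mono) auto
      also have "\<dots> \<le> Max ((\<lambda>k. b k / B k) ` {1..p-1})"
        using i' by (intro Max_ge) auto
      also have "\<dots> \<le> (b p - 1) / B p"
        using mx i' by blast
      finally show ?thesis using AB i' by blast
    qed simp
    then have "0 \<le> P_diff p p A B a b u"
      using u A_pos B_pos pq ab eq by (intro P_diff_nonneg_pairwise) auto
    with pq show ?thesis by simp
  next
    assume pq: "p = q" and mono: "mono_on {1..p} (\<lambda>i. b i / B i)" "mono_on {1..p} (\<lambda>i. 1 / B i)"
      and le: "\<forall>k\<in>{1..p}. (\<Sum>i=1..k. a i / A i) \<le> (\<Sum>i=1..k. b i / B i) \<and>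
                       (\<Sum>i=1..k. 1 / A i) \<le> (\<Sum>i=1..k. 1 / B i)"
    have "0 \<le> P_diff p p A B a b u"
      using u A_pos B_pos pq mono le by (intro P_diff_nonneg_majorization) auto
    with pq show ?thesis by simp
  qed
qed

end
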